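(* Let $\gamma$ be a nonzero real constant. The point transformations $$\Phi_1:\quad \tilde t=e^{\gamma t},\quad \tilde x=e^{\frac12\gamma t}\bigl(x+\tfrac32\gamma y\bigr),\quad \tilde y=\gamma e^{\frac32\gamma t}y,\quad \tilde u=e^{-\frac14(x+\frac32\gamma y)^2-\frac32\gamma t}u,$$ $$\Phi_2:\quad \tilde t=2e^{\frac12\gamma t},\quad \tilde x=e^{\frac14\gamma t}\bigl(x+\tfrac34\gamma y\bigr),\quad \tilde y=\gamma e^{\frac34\gamma t}y,\quad \tilde u=e^{-\gamma t}u$$ respectively map the Kramers equations $$u_t+xu_y=\gamma u_{xx}+\gamma\bigl(x-\tfrac34\gamma y\bigr)u_x+\gamma u\qquad\text{and}\qquad u_t+xu_y=\gamma u_{xx}+\gamma\bigl(x+\tfrac3{16}\gamma y\bigr)u_x+\gamma u$$ to the equation $\tilde u_{\tilde t}+\tilde x\tilde u_{\tilde y}=\tilde u_{\tilde x\tilde x}$. In other words, an arbitrary solution $\tilde u=f(\tilde t,\tilde x,\tilde y)$ of the latter equation is pulled back by $\Phi_1$ and $\Phi_2$ to the solutions $$u=e^{\frac14(x+\frac32\gamma y)^2+\frac32\gamma t}f\Bigl(e^{\gamma t},\,e^{\frac12\gamma t}\bigl(x+\tfrac32\gamma y\bigr),\,\gamma e^{\frac32\gamma t}y\Bigr)\qquad\text{and}\qquad u=e^{\gamma t}f\Bigl(2e^{\frac12\gamma t},\,e^{\frac14\gamma t}\bigl(x+\tfrac34\gamma y\bigr),\,\gamma e^{\frac34\gamma t}y\Bigr)$$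 of the first and the second Kramers equations, respectively.
   Context: All equations are for real functions of three real independent variables ($u=u(t,x,y)$ and $\tilde u=\tilde u(\tilde t,\tilde x,\tilde y)$). A point transformation is a local diffeomorphism between the spaces with coordinates $(t,x,y,u)$ and $(\tilde t,\tilde x,\tilde y,\tilde u)$; it maps one equation to another if it transforms solutions of the first one into solutions of the second one and conversely. Variables without tildes correspond to the source Kramers equation and variables with tildes to the target equation. *)

theory Defs
  imports "HOL-Analysis.Analysis" "HOL-Library.Extended_Nat"
begin

section \<open>Functions of class \<open>C\<^sup>k\<close> on open sets\<close>

text \<open>
  In finite dimension a map is \<open>C\<^sup>n\<^sup>+\<^sup>1\<close> on an open set iff it is differentiable there and all its
  directional derivatives are \<open>C\<^sup>n\<close>. The definitions are only meant for open sets \<open>S\<close>.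
\<close>

primrec Cn_on :: "nat \<Rightarrow> 'a::euclidean_space set \<Rightarrow> ('a \<Rightarrow> 'b::euclidean_space) \<Rightarrow> bool" where
  "Cn_on 0 S f \<longleftrightarrow> continuous_on S f"
| "Cn_on (Suc n) S f \<longleftrightarrow>
     f differentiable_on S \<and> (\<forall>v. Cn_on n S (\<lambda>p. frechet_derivative f (at p) v))"

definition Ck_on :: "enat \<Rightarrow> 'a::euclidean_space set \<Rightarrow> ('a \<Rightarrow> 'b::euclidean_space) \<Rightarrow> bool" where
  "Ck_on k S f \<longleftrightarrow> (\<forall>n. enat n \<le> k \<longrightarrow> Cn_on n S f)"

section \<open>Point transformations\<close>

definition diffeo_on :: "'a::euclidean_space set \<Rightarrow> ('a \<Rightarrow> 'a) \<Rightarrow> bool" where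
  "diffeo_on V \<Phi> \<longleftrightarrow> open V \<and> inj_on \<Phi> V \<and> open (\<Phi> ` V)
     \<and> Ck_on \<infinity> V \<Phi> \<and> Ck_on \<infinity> (\<Phi> ` V) (inv_into V \<Phi>)"

type_synonym point = "real \<times> real \<times> real"          \<comment> \<open>\<open>(t, x, y)\<close>\<close>
type_synonym upoint = "real \<times> real \<times> real \<times> real"  \<comment> \<open>\<open>(t, x, y, u)\<close>\<close>

definition point_transformation :: "(upoint \<Rightarrow> upoint) \<Rightarrow> bool" where
  "point_transformation \<Phi> \<longleftrightarrow> (\<forall>z. \<exists>V. z \<in> V \<and> diffeo_on V \<Phi>)"

section \<open>Equations and their solutions\<close>

fun D\<^sub>t :: "(point \<Rightarrow> real) \<Rightarrow> point \<Rightarrow> real" where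
  "D\<^sub>t u (t, x, y) = deriv (\<lambda>s. u (s, x, y)) t"

fun D\<^sub>x :: "(point \<Rightarrow> real) \<Rightarrow> point \<Rightarrow> real" where
  "D\<^sub>x u (t, x, y) = deriv (\<lambda>s. u (t, s, y)) x"

fun D\<^sub>y :: "(point \<Rightarrow> real) \<Rightarrow> point \<Rightarrow> real" where
  "D\<^sub>y u (t, x, y) = deriv (\<lambda>s. u (t, x, s)) y"

text \<open>An equation is the predicate saying that a function satisfies it at a given point.\<close>

type_synonym equation = "(point \<Rightarrow> real) \<Rightarrow> point \<Rightarrow> bool"

fun kramers\<^sub>1 :: "real \<Rightarrow> equation" where
  "kramers\<^sub>1 \<gamma> u (t, x, y) \<longleftrightarrow>
     D\<^sub>t u (t, x, y) + x * D\<^sub>y u (t, x, y)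
     = \<gamma> * D\<^sub>x (D\<^sub>x u) (t, x, y) + \<gamma> * (x - 3/4 * \<gamma> * y) * D\<^sub>x u (t, x, y) + \<gamma> * u (t, x, y)"

fun kramers\<^sub>2 :: "real \<Rightarrow> equation" where
  "kramers\<^sub>2 \<gamma> u (t, x, y) \<longleftrightarrow>
     D\<^sub>t u (t, x, y) + x * D\<^sub>y u (t, x, y)
     = \<gamma> * D\<^sub>x (D\<^sub>x u) (t, x, y) + \<gamma> * (x + 3/16 * \<gamma> * y) * D\<^sub>x u (t, x, y) + \<gamma> * u (t, x, y)"

fun kolmogorov :: equation where
  "kolmogorov u (t, x, y) \<longleftrightarrow> D\<^sub>t u (t, x, y) + x * D\<^sub>y u (t, x, y) = D\<^sub>x (D\<^sub>x u) (t, x, y)"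

text \<open>Solutions are local: \<open>u\<close> matters only on the open set \<open>\<Omega>\<close>, its domain.\<close>

definition solution :: "enat \<Rightarrow> equation \<Rightarrow> point set \<Rightarrow> (point \<Rightarrow> real) \<Rightarrow> bool" where
  "solution k E \<Omega> u \<longleftrightarrow> open \<Omega> \<and> Ck_on k \<Omega> u \<and> (\<forall>p\<in>\<Omega>. E u p)"

section \<open>Action of point transformations on solutions\<close>

definition graph_on :: "point set \<Rightarrow> (point \<Rightarrow> real) \<Rightarrow> upoint set" where
  "graph_on \<Omega> u = {(t, x, y, u (t, x, y)) | t x y. (t, x, y) \<in> \<Omega>}"

text \<open>
  A point transformation \<open>\<Phi>\<close> takes \<open>u\<close> to \<open>u'\<close> if it takes the graph of \<open>u\<close> to the graph of \<open>u'\<close>.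
  As \<open>\<Phi>\<close> need not be surjective, the converse direction concerns the target solutions
  whose graphs lie in the image of \<open>\<Phi>\<close>.
\<close>

definition maps_equation ::
  "enat \<Rightarrow> (upoint \<Rightarrow> upoint) \<Rightarrow> equation \<Rightarrow> equation \<Rightarrow> bool" where
  "maps_equation k \<Phi> E E' \<longleftrightarrow>
     (\<forall>\<Omega> u. solution k E \<Omega> u \<longrightarrow>
        (\<exists>\<Omega>' u'. solution k E' \<Omega>' u' \<and> \<Phi> ` graph_on \<Omega> u = graph_on \<Omega>' u')) \<and>
     (\<forall>\<Omega>' u'. solution k E' \<Omega>' u' \<and> graph_on \<Omega>' u' \<subseteq> range \<Phi> \<longrightarrow>
        (\<exists>\<Omega> u. solution k E \<Omega> u \<and> \<Phi> ` graph_on \<Omega> u = graph_on \<Omega>' u'))"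

text \<open>\<open>\<Phi>\<close> pulls \<open>u'\<close> on \<open>\<Omega>'\<close> back to \<open>u\<close> on \<open>\<Omega>\<close>.\<close>

definition pulls_back ::
  "(upoint \<Rightarrow> upoint) \<Rightarrow> point set \<Rightarrow> (point \<Rightarrow> real) \<Rightarrow> point set \<Rightarrow> (point \<Rightarrow> real) \<Rightarrow> bool" where
  "pulls_back \<Phi> \<Omega>' u' \<Omega> u \<longleftrightarrow> \<Phi> -` graph_on \<Omega>' u' = graph_on \<Omega> u"

section \<open>The two transformations\<close>

fun \<Phi>\<^sub>1 :: "real \<Rightarrow> upoint \<Rightarrow> upoint" where
  "\<Phi>\<^sub>1 \<gamma> (t, x, y, u) =
     (exp (\<gamma> * t),
      exp (1/2 * \<gamma> * t) * (x + 3/2 * \<gamma> * y),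
      \<gamma> * exp (3/2 * \<gamma> * t) * y,
      exp (- (1/4) * (x + 3/2 * \<gamma> * y)\<^sup>2 - 3/2 * \<gamma> * t) * u)"

fun \<Phi>\<^sub>2 :: "real \<Rightarrow> upoint \<Rightarrow> upoint" where
  "\<Phi>\<^sub>2 \<gamma> (t, x, y, u) =
     (2 * exp (1/2 * \<gamma> * t),
      exp (1/4 * \<gamma> * t) * (x + 3/4 * \<gamma> * y),
      \<gamma> * exp (3/4 * \<gamma> * t) * y,
      exp (- \<gamma> * t) * u)"

end

theory Submission imports Defs begin

text \<open>
  Both transformations have the form
  \<open>T = \<kappa> e\<^bsup>2\<alpha>t\<^esup>\<close>, \<open>X = e\<^bsup>\<alpha>t\<^esup> w\<close>, \<open>Y = \<gamma> e\<^bsup>3\<alpha>t\<^esup> y\<close>, \<open>U = e\<^bsup>-(l w\<^sup>2 + \<mu>t)\<^esup> u\<close> with \<open>w = x + 3\<alpha>y\<close>,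
  \<open>\<kappa> > 0\<close> and \<open>\<gamma> = 2\<alpha>\<kappa>\<close>, so each is a diffeomorphism of the whole space onto the half-space
  \<open>T > 0\<close>. By the chain rule, the Kramers operator applied to the pullback of \<open>f\<close> is the pullback of the
  Kolmogorov operator applied to \<open>f\<close> up to a nonvanishing factor, provided that the coefficients of \<open>f\<close> and
  of its \<open>X\<close>-derivative cancel. As every \<open>u\<close> is the pullback of its own pushforward, this one equivalence
  gives both directions.
\<close>

section \<open>Calculus of \<open>C\<^sup>n\<close> maps\<close>

lemma Cn_on_SucD:
  assumes "Cn_on (Suc n) S f" "open S" "p \<in> S"
  shows "(f has_derivative frechet_derivative f (at p)) (at p)"
  using assms by (metis Cn_on.simps(2) at_within_open differentiable_on_def frechet_derivative_works)

text \<open>On an open set the derivative at a point depends only on nearby values, so agreement of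
  \<open>f\<close> and \<open>g\<close> passes to their directional derivatives and the induction
  continues with those.\<close>

lemma Cn_on_cong:
  assumes "open S" "\<And>p. p \<in> S \<Longrightarrow> f p = g p" "Cn_on n S f"
  shows "Cn_on n S g"
  using assms(2,3)
proof (induction n arbitrary: f g)
  case 0
  then show ?case by (simp cong: continuous_on_cong)
next
  case (Suc n)
  have g': "(g has_derivative frechet_derivative f (at p)) (at p)" if "p \<in> S" for p
    using Cn_on_SucD[OF Suc.prems(2) \<open>open S\<close> that] \<open>open S\<close> that Suc.prems(1)
    by (rule has_derivative_transform_within_open)
  then have "g differentiable_on S"
    by (metis differentiable_at_withinI differentiableI differentiable_on_def)
  moreover have "Cn_on n S (\<lambda>p. frechet_derivative g (at p) v)" for v
  proof (rule Suc.IH)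
    show "frechet_derivative f (at p) v = frechet_derivative g (at p) v" if "p \<in> S" for p
      using frechet_derivative_at[OF g'[OF that]] by simp
    show "Cn_on n S (\<lambda>p. frechet_derivative f (at p) v)" using Suc.prems(2) by simp
  qed
  ultimately show ?case by simp
qed

text \<open>\<open>frechet_derivative\<close> is a choice operator; uniqueness of derivatives lets
  an explicit formula \<open>f'\<close> stand in for it. The rules for addition, products and
  composition induct through this one.\<close>

lemma Cn_on_SucI:
  assumes "open S" and f': "\<And>p. p \<in> S \<Longrightarrow> (f has_derivative f' p) (at p)"
    and "\<And>v. Cn_on n S (\<lambda>p. f' p v)"
  shows "Cn_on (Suc n) S f"
proof -
  have "f differentiable_on S"
    using f' by (metis differentiable_at_withinI differentiableI differentiable_on_def)
  moreover have "Cn_on n S (\<lambda>p. frechet_derivative f (at p) v)" for v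
  proof (rule Cn_on_cong[OF \<open>open S\<close> _ assms(3)])
    show "f' p v = frechet_derivative f (at p) v" if "p \<in> S" for p
      using frechet_derivative_at[OF f'[OF that]] by simp
  qed
  ultimately show ?thesis by simp
qed

lemma Cn_on_Suc_imp: "Cn_on (Suc n) S f \<Longrightarrow> Cn_on n S f"
  by (induction n arbitrary: f) (auto simp: differentiable_imp_continuous_on)

lemma Cn_on_frechet_derivative:
  "Cn_on (Suc n) S f \<Longrightarrow> Cn_on n S (\<lambda>p. frechet_derivative f (at p) v)"
  by simp

lemma Cn_on_subset: "Cn_on n S f \<Longrightarrow> T \<subseteq> S \<Longrightarrow> Cn_on n T f"
  by (induction n arbitrary: f) (auto intro: continuous_on_subset differentiable_on_subset)

lemma Cn_on_const: "Cn_on n S (\<lambda>p. c)"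
  by (induction n arbitrary: c) auto

lemma Cn_on_linear:
  assumes "bounded_linear L" "open S" "Cn_on n S f"
  shows "Cn_on n S (\<lambda>p. L (f p))"
  using assms(3)
proof (induction n arbitrary: f)
  case 0
  then show ?case using assms(1) by (auto intro: bounded_linear.continuous_on)
next
  case (Suc n)
  show ?case
  proof (rule Cn_on_SucI[OF \<open>open S\<close>])
    show "((\<lambda>p. L (f p)) has_derivative (\<lambda>v. L (frechet_derivative f (at p) v))) (at p)"
      if "p \<in> S" for p
      using bounded_linear.has_derivative[OF assms(1) Cn_on_SucD[OF Suc.prems \<open>open S\<close> that]] .
    show "Cn_on n S (\<lambda>p. L (frechet_derivative f (at p) v))" for v
      using Suc by simp
  qed
qed

lemma Cn_on_add:
  assumes "open S" "Cn_on n S f" "Cn_on n S g"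
  shows "Cn_on n S (\<lambda>p. f p + g p)"
  using assms(2,3)
proof (induction n arbitrary: f g)
  case 0
  then show ?case by (auto intro: continuous_intros)
next
  case (Suc n)
  show ?case
  proof (rule Cn_on_SucI[OF \<open>open S\<close>])
    show "((\<lambda>p. f p + g p) has_derivative
        (\<lambda>v. frechet_derivative f (at p) v + frechet_derivative g (at p) v)) (at p)"
      if "p \<in> S" for p
      using has_derivative_add[OF Cn_on_SucD[OF Suc.prems(1) \<open>open S\<close> that]
          Cn_on_SucD[OF Suc.prems(2) \<open>open S\<close> that]] .
    show "Cn_on n S (\<lambda>p. frechet_derivative f (at p) v + frechet_derivative g (at p) v)" for v
      by (intro Suc.IH Suc.prems[THEN Cn_on_frechet_derivative])
  qed
qed

text \<open>Leibniz rule: its terms contain \<open>f\<close> and \<open>g\<close> themselves, which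
  \<open>Cn_on_Suc_imp\<close> lowers to the class of the induction hypothesis. The form scalar
  times vector is what the chain rule below needs.\<close>

lemma Cn_on_scaleR:
  fixes f :: "'a::euclidean_space \<Rightarrow> real"
  assumes "open S" "Cn_on n S f" "Cn_on n S g"
  shows "Cn_on n S (\<lambda>p. f p *\<^sub>R g p)"
  using assms(2,3)
proof (induction n arbitrary: f g)
  case 0
  then show ?case by (auto intro: continuous_intros)
next
  case (Suc n)
  show ?case
  proof (rule Cn_on_SucI[OF \<open>open S\<close>])
    show "((\<lambda>p. f p *\<^sub>R g p) has_derivative
        (\<lambda>v. f p *\<^sub>R frechet_derivative g (at p) v + frechet_derivative f (at p) v *\<^sub>R g p)) (at p)"
      if "p \<in> S" for p
      using has_derivative_scaleR[OF Cn_on_SucD[OF Suc.prems(1) \<open>open S\<close> that]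
          Cn_on_SucD[OF Suc.prems(2) \<open>open S\<close> that]] .
    show "Cn_on n S (\<lambda>p. f p *\<^sub>R frechet_derivative g (at p) v
        + frechet_derivative f (at p) v *\<^sub>R g p)" for v
      by (intro Cn_on_add[OF \<open>open S\<close>] Suc.IH Suc.prems[THEN Cn_on_Suc_imp]
          Suc.prems[THEN Cn_on_frechet_derivative])
  qed
qed

lemma Cn_on_mult:
  fixes f g :: "'a::euclidean_space \<Rightarrow> real"
  shows "open S \<Longrightarrow> Cn_on n S f \<Longrightarrow> Cn_on n S g \<Longrightarrow> Cn_on n S (\<lambda>p. f p * g p)"
  using Cn_on_scaleR[of S n f g] by simp

lemma Cn_on_sum:
  assumes "open S" "\<And>i. i \<in> I \<Longrightarrow> Cn_on n S (f i)"
  shows "Cn_on n S (\<lambda>p. \<Sum>i\<in>I. f i p)"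
  using assms(2)
  by (induction I rule: infinite_finite_induct) (auto intro: Cn_on_const Cn_on_add[OF \<open>open S\<close>])

lemma Cn_on_compose:
  assumes "open S" "open T" "Cn_on n S f" "Cn_on n T g" "f ` S \<subseteq> T"
  shows "Cn_on n S (\<lambda>p. g (f p))"
  using assms(3,4,5)
proof (induction n arbitrary: g)
  case 0
  then show ?case by (auto intro: continuous_on_compose2)
next
  case (Suc n)
  let ?F = "\<lambda>p. frechet_derivative f (at p)" and ?G = "\<lambda>q. frechet_derivative g (at q)"
  have lin: "linear (?G (f p))" if "p \<in> S" for p
    using Cn_on_SucD[OF Suc.prems(2) \<open>open T\<close>, of "f p"] that Suc.prems(3)
    by (auto intro: has_derivative_linear)
  show ?case
  proof (rule Cn_on_SucI[OF \<open>open S\<close>])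
    show "((\<lambda>p. g (f p)) has_derivative (\<lambda>v. ?G (f p) (?F p v))) (at p)" if "p \<in> S" for p
    proof -
      have "(g has_derivative ?G (f p)) (at (f p))"
        by (rule Cn_on_SucD[OF Suc.prems(2) \<open>open T\<close>]) (use that Suc.prems(3) in auto)
      from has_derivative_compose[OF Cn_on_SucD[OF Suc.prems(1) \<open>open S\<close> that] this]
      show ?thesis .
    qed
    \<comment> \<open>The direction \<open>?F p v\<close> moves with \<open>p\<close>, whereas the
      induction hypothesis applies to derivatives of \<open>g\<close> in a fixed direction.
      Expanding in \<open>Basis\<close> leaves fixed directions \<open>b\<close> with scalar
      coefficients depending on \<open>p\<close>.\<close>
    show "Cn_on n S (\<lambda>p. ?G (f p) (?F p v))" for v
    proof (rule Cn_on_cong[OF \<open>open S\<close>])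
      show "(\<Sum>b\<in>Basis. (?F p v \<bullet> b) *\<^sub>R ?G (f p) b) = ?G (f p) (?F p v)" if "p \<in> S" for p
      proof -
        have "?G (f p) (?F p v) = ?G (f p) (\<Sum>b\<in>Basis. (?F p v \<bullet> b) *\<^sub>R b)"
          by (simp only: euclidean_representation)
        then show ?thesis by (simp add: linear_sum[OF lin[OF that]] linear_cmul[OF lin[OF that]])
      qed
      show "Cn_on n S (\<lambda>p. \<Sum>b\<in>Basis. (?F p v \<bullet> b) *\<^sub>R ?G (f p) b)"
        by (intro Cn_on_sum Cn_on_scaleR \<open>open S\<close> Suc.IH Cn_on_Suc_imp[OF Suc.prems(1)]
            Cn_on_linear[OF bounded_linear_inner_left] Suc.prems(3)
            Suc.prems(1,2)[THEN Cn_on_frechet_derivative])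
    qed
  qed
qed

text \<open>A pair is the sum of its images under the linear embeddings into the two
  factors.\<close>

lemma Cn_on_Pair:
  assumes "open S" "Cn_on n S f" "Cn_on n S g"
  shows "Cn_on n S (\<lambda>p. (f p, g p))"
proof -
  have "bounded_linear (\<lambda>a. (a, 0::'c))" "bounded_linear (\<lambda>b. (0::'b, b))"
    by (intro bounded_linear_Pair bounded_linear_ident bounded_linear_zero)+
  from Cn_on_add[OF \<open>open S\<close> Cn_on_linear[OF this(1) assms(1,2)] Cn_on_linear[OF this(2) assms(1,3)]]
  show ?thesis by simp
qed

lemma Cn_on_bounded_linear:
  assumes "bounded_linear L"
  shows "Cn_on n S L"
proof (cases n)
  case 0
  then show ?thesis using assms by (simp add: linear_continuous_on)
next
  case (Suc m)
  have "frechet_derivative L (at p) = L" for p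
    using assms bounded_linear_imp_has_derivative frechet_derivative_at by metis
  then show ?thesis
    using Suc assms by (simp add: Cn_on_const bounded_linear_imp_differentiable_on)
qed

section \<open>Smoothness of the exponential and the logarithm\<close>

lemma Cn_on_exp_real: "Cn_on n UNIV (exp :: real \<Rightarrow> real)"
proof (induction n)
  case (Suc n)
  have "((exp :: real \<Rightarrow> real) has_derivative (\<lambda>v. exp x * v)) (at x)" for x :: real
    using DERIV_exp[of x] by (simp add: has_field_derivative_def)
  then show ?case
    by (rule Cn_on_SucI[OF open_UNIV])
      (intro Cn_on_mult Cn_on_const Suc.IH open_UNIV)
qed (simp add: continuous_on_exp)

lemma Cn_on_exp:
  fixes f :: "'a::euclidean_space \<Rightarrow> real"
  shows "open S \<Longrightarrow> Cn_on n S f \<Longrightarrow> Cn_on n S (\<lambda>p. exp (f p))"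
  by (rule Cn_on_compose[OF _ open_UNIV _ Cn_on_exp_real]) auto

lemma Cn_on_ln_real: "Cn_on n {0<..} (ln :: real \<Rightarrow> real)"
proof (induction n)
  case 0
  then show ?case by (auto intro!: continuous_intros)
next
  case (Suc n)
  \<comment> \<open>Writing \<open>1 / x\<close> as \<open>exp (-1 * ln x)\<close> expresses the
    derivative through \<open>ln\<close> itself, so the induction hypothesis and
    \<open>Cn_on_exp\<close> suffice.\<close>
  have "((ln :: real \<Rightarrow> real) has_derivative (\<lambda>v. exp (-1 * ln x) * v)) (at x)"
    if "x \<in> {0<..}" for x :: real
    using DERIV_ln[of x] that by (simp add: has_field_derivative_def exp_minus)
  then show ?case
    by (rule Cn_on_SucI[OF open_greaterThan], blast)
      (intro Cn_on_mult Cn_on_exp Cn_on_const Suc.IH open_greaterThan)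
qed

lemma Cn_on_ln:
  fixes f :: "'a::euclidean_space \<Rightarrow> real"
  shows "open S \<Longrightarrow> Cn_on n S f \<Longrightarrow> (\<And>p. p \<in> S \<Longrightarrow> 0 < f p) \<Longrightarrow> Cn_on n S (\<lambda>p. ln (f p))"
  by (rule Cn_on_compose[OF _ open_greaterThan _ Cn_on_ln_real]) auto

lemma Cn_on_power:
  fixes f :: "'a::euclidean_space \<Rightarrow> real"
  shows "open S \<Longrightarrow> Cn_on n S f \<Longrightarrow> Cn_on n S (\<lambda>p. f p ^ m)"
  by (induction m) (auto intro: Cn_on_const Cn_on_mult)

lemma Cn_on_diff:
  fixes f g :: "'a::euclidean_space \<Rightarrow> real"
  shows "open S \<Longrightarrow> Cn_on n S f \<Longrightarrow> Cn_on n S g \<Longrightarrow> Cn_on n S (\<lambda>p. f p - g p)"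
  using Cn_on_add[of S n f "\<lambda>p. -1 * g p"] Cn_on_mult[OF _ Cn_on_const[of n S "-1"], of g]
  by simp

lemma Cn_on_ident: "Cn_on n S (\<lambda>p. p)"
  by (rule Cn_on_bounded_linear[OF bounded_linear_ident])

lemma Cn_on_fst: "open S \<Longrightarrow> Cn_on n S f \<Longrightarrow> Cn_on n S (\<lambda>p. fst (f p))"
  and Cn_on_snd: "open S \<Longrightarrow> Cn_on n S f \<Longrightarrow> Cn_on n S (\<lambda>p. snd (f p))"
  by (fact Cn_on_linear[OF bounded_linear_fst], fact Cn_on_linear[OF bounded_linear_snd])

lemmas Cn_on_intros = Cn_on_const Cn_on_add Cn_on_diff Cn_on_mult Cn_on_power Cn_on_exp Cn_on_Pair
  Cn_on_ident Cn_on_fst Cn_on_snd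

section \<open>Partial derivatives\<close>

text \<open>Chain rule along a curve with velocity \<open>(T', X', Y')\<close>. Coordinate lines
  give the partial derivatives.\<close>

lemma DERIV_compose_curve:
  assumes "(f has_derivative f') (at (T s, X s, Y s))"
    and "(T has_real_derivative T') (at s)" "(X has_real_derivative X') (at s)"
    "(Y has_real_derivative Y') (at s)"
  shows "((\<lambda>s. f (T s, X s, Y s)) has_real_derivative f' (T', X', Y')) (at s)"
proof -
  have "((\<lambda>s. (T s, X s, Y s)) has_derivative (\<lambda>h. (T' * h, X' * h, Y' * h))) (at s)"
    using assms(2-4) by (intro has_derivative_Pair) (simp_all add: has_field_derivative_def)
  from has_derivative_compose[OF this assms(1)]
  have "((\<lambda>s. f (T s, X s, Y s)) has_derivative (\<lambda>h. f' (T' * h, X' * h, Y' * h))) (at s)" .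
  moreover have "f' (T' * h, X' * h, Y' * h) = f' (T', X', Y') * h" for h
    using linear_cmul[OF has_derivative_linear[OF assms(1)], of h "(T', X', Y')"]
    by (simp add: mult.commute)
  ultimately show ?thesis by (simp add: has_field_derivative_def)
qed

lemma partial_derivatives:
  assumes "(f has_derivative f') (at p)"
  shows "D\<^sub>t f p = f' (1, 0, 0)" "D\<^sub>x f p = f' (0, 1, 0)" "D\<^sub>y f p = f' (0, 0, 1)"
proof -
  obtain t x y where p: "p = (t, x, y)" by (cases p)
  note curve = DERIV_compose_curve[where f = f and f' = f', THEN DERIV_imp_deriv]
  show "D\<^sub>t f p = f' (1, 0, 0)"
    using curve[of "\<lambda>s. s" t "\<lambda>s. x" "\<lambda>s. y"] assms by (simp add: p)
  show "D\<^sub>x f p = f' (0, 1, 0)"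
    using curve[of "\<lambda>s. t" x "\<lambda>s. s" "\<lambda>s. y"] assms by (simp add: p)
  show "D\<^sub>y f p = f' (0, 0, 1)"
    using curve[of "\<lambda>s. t" y "\<lambda>s. x" "\<lambda>s. s"] assms by (simp add: p)
qed

text \<open>Linearity splits the velocity along the coordinate axes. The value \<open>D\<close> is
  tied by an equation so that each application can prescribe its shape.\<close>

lemma DERIV_chain_partial:
  assumes "f differentiable (at (T s, X s, Y s))"
    and "(T has_real_derivative T') (at s)" "(X has_real_derivative X') (at s)"
    "(Y has_real_derivative Y') (at s)"
    and "D = T' * D\<^sub>t f (T s, X s, Y s) + X' * D\<^sub>x f (T s, X s, Y s) + Y' * D\<^sub>y f (T s, X s, Y s)"
  shows "((\<lambda>s. f (T s, X s, Y s)) has_real_derivative D) (at s)"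
proof -
  obtain f' where f': "(f has_derivative f') (at (T s, X s, Y s))"
    using assms(1) by (auto simp: differentiable_def)
  have lin: "linear f'" using f' by (rule has_derivative_linear)
  have "f' (T', X', Y') = f' (T' *\<^sub>R (1, 0, 0) + X' *\<^sub>R (0, 1, 0) + Y' *\<^sub>R (0, 0, 1))"
    by simp
  also have "\<dots> = T' * f' (1, 0, 0) + X' * f' (0, 1, 0) + Y' * f' (0, 0, 1)"
    unfolding linear_add[OF lin] linear_cmul[OF lin] by simp
  also have "\<dots> = D" using assms(5) partial_derivatives[OF f'] by simp
  finally show ?thesis using DERIV_compose_curve[OF f' assms(2-4)] by simp
qed

lemma Cn_on_differentiable_at: "Cn_on (Suc n) S f \<Longrightarrow> open S \<Longrightarrow> p \<in> S \<Longrightarrow> f differentiable (at p)"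
  by (metis Cn_on_SucD differentiableI)

text \<open>On \<open>S\<close> the partial derivative is the directional derivative along
  \<open>(0, 1, 0)\<close>, whose class is part of the definition of \<open>Cn_on\<close>.\<close>

lemma Cn_on_D\<^sub>x:
  assumes "Cn_on (Suc n) S f" "open S"
  shows "Cn_on n S (D\<^sub>x f)"
  by (rule Cn_on_cong[OF assms(2) _ Cn_on_frechet_derivative[OF assms(1), of "(0, 1, 0)"]])
    (rule partial_derivatives(2)[OF Cn_on_SucD[OF assms], symmetric])

section \<open>A family of point transformations\<close>

fun kramers :: "real \<Rightarrow> real \<Rightarrow> equation" where
  "kramers \<gamma> \<beta> u (t, x, y) \<longleftrightarrow>
     D\<^sub>t u (t, x, y) + x * D\<^sub>y u (t, x, y)
     = \<gamma> * D\<^sub>x (D\<^sub>x u) (t, x, y) + \<gamma> * (x + \<beta> * y) * D\<^sub>x u (t, x, y) + \<gamma> * u (t, x, y)"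

text \<open>
  The assumptions \<open>drift_x\<close> and \<open>drift_y\<close> make the coefficient of \<open>f\<^sub>X\<close> vanish in the transformed equation;
  \<open>weight_1\<close>, \<open>weight_x\<close> and \<open>weight_y\<close> do the same for the coefficient of \<open>f\<close>.
\<close>

locale kramers_to_kolmogorov =
  fixes \<gamma> \<alpha> \<kappa> l \<mu> \<beta> :: real
  assumes \<gamma>_nonzero: "\<gamma> \<noteq> 0" and \<kappa>_pos: "0 < \<kappa>" and \<gamma>_eq: "\<gamma> = 2 * \<alpha> * \<kappa>"
    and drift_x: "4 * \<alpha> = 4 * \<gamma> * l + \<gamma>"
    and drift_y: "3 * \<alpha>\<^sup>2 = 12 * \<gamma> * l * \<alpha> + \<gamma> * \<beta>"
    and weight_1: "\<mu> = 2 * l * \<gamma> + \<gamma>"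
    and weight_x: "l * (3 * \<alpha> - 2 * \<gamma> * l - \<gamma>) = 0"
    and weight_y: "l * (6 * \<gamma> * l * \<alpha> + \<gamma> * \<beta>) = 0"
begin

section \<open>The change of independent variables and the multiplier of \<open>u\<close>\<close>

lemma \<alpha>_nonzero: "\<alpha> \<noteq> 0"
  using \<gamma>_nonzero \<gamma>_eq by auto

text \<open>The new independent variables do not involve \<open>u\<close>, so domains of solutions
  are transported by this map alone.\<close>

definition base :: "point \<Rightarrow> point" where
  "base = (\<lambda>(t, x, y).
     (\<kappa> * exp (2 * \<alpha> * t), exp (\<alpha> * t) * (x + 3 * \<alpha> * y), \<gamma> * exp (3 * \<alpha> * t) * y))"

text \<open>Solves for \<open>t\<close>, then \<open>y\<close>, then \<open>x\<close>. Constant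
  factors \<open>inverse\<close> and \<open>- 1 *\<close> replace division and negation to fit the
  shapes in \<open>Cn_on_intros\<close>.\<close>

definition base_inv :: "point \<Rightarrow> point" where
  "base_inv = (\<lambda>(T, X, Y).
     let t = (ln T - ln \<kappa>) * inverse (2 * \<alpha>); y = inverse \<gamma> * exp (- 1 * (3 * \<alpha> * t)) * Y
     in (t, exp (- 1 * (\<alpha> * t)) * X - 3 * \<alpha> * y, y))"

definition weight :: "point \<Rightarrow> real" where
  "weight = (\<lambda>(t, x, y). exp (l * (x + 3 * \<alpha> * y)\<^sup>2 + \<mu> * t))"

definition inv_weight :: "point \<Rightarrow> real" where
  "inv_weight = (\<lambda>(t, x, y). exp (-1 * (l * (x + 3 * \<alpha> * y)\<^sup>2 + \<mu> * t)))"

definition \<Phi> :: "upoint \<Rightarrow> upoint" where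
  "\<Phi> = (\<lambda>(t, x, y, u). case base (t, x, y) of (T, X, Y) \<Rightarrow> (T, X, Y, inv_weight (t, x, y) * u))"

definition \<Phi>_inv :: "upoint \<Rightarrow> upoint" where
  "\<Phi>_inv = (\<lambda>(T, X, Y, U).
     case base_inv (T, X, Y) of (t, x, y) \<Rightarrow> (t, x, y, weight (t, x, y) * U))"

definition pullback :: "(point \<Rightarrow> real) \<Rightarrow> point \<Rightarrow> real" where
  "pullback f = (\<lambda>p. weight p * f (base p))"

text \<open>Since \<open>base_inv (base p) = p\<close> everywhere, pulling this back returns
  \<open>u\<close> for every \<open>u\<close>. In the other order the original function is recovered
  where the first coordinate is positive.\<close>

definition pushforward :: "(point \<Rightarrow> real) \<Rightarrow> point \<Rightarrow> real" where
  "pushforward u = (\<lambda>q. inv_weight (base_inv q) * u (base_inv q))"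

text \<open>The trailing factor \<open>a\<close> lets the simplifier cancel the two weights inside
  right-nested products.\<close>

lemma weight_inv_weight [simp]:
  "weight p * (inv_weight p * a) = a" "inv_weight p * (weight p * a) = a"
proof -
  have inverse: "weight p * inv_weight p = 1"
    by (cases p) (simp add: weight_def inv_weight_def flip: exp_add)
  then show "weight p * (inv_weight p * a) = a" by (simp flip: mult.assoc)
  show "inv_weight p * (weight p * a) = a"
    using inverse by (simp add: mult.commute[of "inv_weight p"] flip: mult.assoc)
qed

lemma base_inv_base [simp]: "base_inv (base p) = p"
proof (cases p)
  case (fields t x y)
  have t: "(ln (\<kappa> * exp (2 * \<alpha> * t)) - ln \<kappa>) * inverse (2 * \<alpha>) = t"
    using \<kappa>_pos \<alpha>_nonzero by (simp add: ln_mult field_simps)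
  show ?thesis
    unfolding fields base_def base_inv_def Let_def prod.case t
    using \<gamma>_nonzero by (simp add: exp_minus field_simps)
qed

lemma base_base_inv [simp]:
  assumes "0 < fst q"
  shows "base (base_inv q) = q"
proof (cases q)
  case (fields T X Y)
  define t where "t = (ln T - ln \<kappa>) * inverse (2 * \<alpha>)"
  have "2 * \<alpha> * t = ln T - ln \<kappa>"
    using \<alpha>_nonzero by (simp add: t_def)
  then have T: "\<kappa> * exp (2 * \<alpha> * t) = T"
    using \<kappa>_pos assms fields by (simp add: exp_diff)
  show ?thesis
    unfolding fields base_def base_inv_def Let_def prod.case t_def[symmetric] T
    using \<gamma>_nonzero by (simp add: exp_minus field_simps)
qed

lemma fst_base_pos [simp]: "0 < fst (base p)"
  using \<kappa>_pos by (cases p) (simp add: base_def)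

text \<open>The second factor is polymorphic because the half-space occurs both among points and
  among points with a \<open>u\<close>-coordinate.\<close>

lemma open_half_space: "open {q::real \<times> 'b::euclidean_space. 0 < fst q}"
  by (intro open_Collect_less continuous_intros)

section \<open>Smoothness of the change of variables and of the multiplier\<close>

lemma Cn_on_base: "open S \<Longrightarrow> Cn_on n S base"
  unfolding base_def case_prod_beta by (intro Cn_on_intros)

lemma Cn_on_weight: "open S \<Longrightarrow> Cn_on n S weight"
  and Cn_on_inv_weight: "open S \<Longrightarrow> Cn_on n S inv_weight"
  unfolding weight_def inv_weight_def case_prod_beta by (intro Cn_on_intros; assumption)+

lemma Cn_on_base_inv: "Cn_on n {q. 0 < fst q} base_inv"
  unfolding base_inv_def case_prod_beta Let_def
  by (intro Cn_on_intros Cn_on_ln open_half_space) auto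

section \<open>The transformation as a diffeomorphism onto a half-space\<close>

lemma \<Phi>_inv_\<Phi>: "\<Phi>_inv (\<Phi> z) = z"
proof (cases z)
  case (fields t x y u)
  obtain T X Y where b: "base (t, x, y) = (T, X, Y)" by (cases "base (t, x, y)")
  then have "base_inv (T, X, Y) = (t, x, y)" by (metis base_inv_base)
  with b show ?thesis by (simp add: \<Phi>_def \<Phi>_inv_def fields)
qed

lemma \<Phi>_\<Phi>_inv:
  assumes "0 < fst z"
  shows "\<Phi> (\<Phi>_inv z) = z"
proof (cases z)
  case (fields T X Y U)
  obtain t x y where b: "base_inv (T, X, Y) = (t, x, y)" by (cases "base_inv (T, X, Y)")
  then have "base (t, x, y) = (T, X, Y)"
    using base_base_inv[of "(T, X, Y)"] assms fields by simp
  with b show ?thesis by (simp add: \<Phi>_def \<Phi>_inv_def fields)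
qed

lemma range_\<Phi>: "range \<Phi> = {z. 0 < fst z}"
proof
  show "{z. 0 < fst z} \<subseteq> range \<Phi>" using \<Phi>_\<Phi>_inv by (metis mem_Collect_eq rangeI subsetI)
  have "0 < fst (\<Phi> (t, x, y, u))" for t x y u
    using fst_base_pos[of "(t, x, y)"] by (cases "base (t, x, y)") (simp add: \<Phi>_def)
  then show "range \<Phi> \<subseteq> {z. 0 < fst z}" by auto
qed

lemma Cn_on_\<Phi>: "Cn_on n UNIV \<Phi>"
proof -
  let ?p = "\<lambda>z::upoint. (fst z, fst (snd z), fst (snd (snd z)))"
  \<comment> \<open>Projections in place of nested case expressions bring the map into the reach of
    the smoothness rules.\<close>
  have eq: "\<Phi> = (\<lambda>z. (fst (base (?p z)), fst (snd (base (?p z))), snd (snd (base (?p z))),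
      inv_weight (?p z) * snd (snd (snd z))))"
    by (auto simp: \<Phi>_def fun_eq_iff split: prod.split)
  have p: "Cn_on n UNIV ?p" by (intro Cn_on_intros open_UNIV)
  have "Cn_on n UNIV (\<lambda>z. base (?p z))" "Cn_on n UNIV (\<lambda>z. inv_weight (?p z))"
    by (rule Cn_on_compose[OF open_UNIV open_UNIV p];
        simp add: Cn_on_base Cn_on_inv_weight)+
  then show ?thesis unfolding eq by (intro Cn_on_intros open_UNIV)
qed

lemma Cn_on_\<Phi>_inv: "Cn_on n {z. 0 < fst z} \<Phi>_inv"
proof -
  let ?q = "\<lambda>z::upoint. (fst z, fst (snd z), fst (snd (snd z)))"
  have eq: "\<Phi>_inv = (\<lambda>z. (fst (base_inv (?q z)), fst (snd (base_inv (?q z))),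
      snd (snd (base_inv (?q z))), weight (base_inv (?q z)) * snd (snd (snd z))))"
    by (auto simp: \<Phi>_inv_def fun_eq_iff split: prod.split)
  have q: "Cn_on n {z. 0 < fst z} ?q" by (intro Cn_on_intros open_half_space)
  have b: "Cn_on n {z. 0 < fst z} (\<lambda>z. base_inv (?q z))"
    by (rule Cn_on_compose[OF open_half_space open_half_space q Cn_on_base_inv]) auto
  have "Cn_on n {z. 0 < fst z} (\<lambda>z. weight (base_inv (?q z)))"
    by (rule Cn_on_compose[OF open_half_space open_UNIV b Cn_on_weight]) auto
  with b show ?thesis unfolding eq by (intro Cn_on_intros open_half_space)
qed

text \<open>Global injectivity lets the whole space serve as the neighbourhood of every point.
  \<open>inv \<Phi>\<close> is matched with \<open>\<Phi>_inv\<close> on the open range, which is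
  enough for \<open>Cn_on_cong\<close>.\<close>

lemma point_transformation_\<Phi>: "point_transformation \<Phi>"
proof -
  have "inj \<Phi>" using \<Phi>_inv_\<Phi> by (metis injI)
  moreover have "Cn_on n (range \<Phi>) (inv \<Phi>)" for n
  proof (rule Cn_on_cong[OF _ _ Cn_on_\<Phi>_inv, folded range_\<Phi>])
    show "open (range \<Phi>)" by (simp add: range_\<Phi> open_half_space)
    show "\<Phi>_inv z = inv \<Phi> z" if "z \<in> range \<Phi>" for z
      using that \<open>inj \<Phi>\<close> by (auto simp: \<Phi>_inv_\<Phi>)
  qed
  ultimately have "diffeo_on UNIV \<Phi>"
    by (simp add: diffeo_on_def Ck_on_def Cn_on_\<Phi> range_\<Phi> open_half_space)
  then show ?thesis unfolding point_transformation_def by blast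
qed

section \<open>Pullback and pushforward of functions and domains\<close>

lemma pullback_pushforward: "pullback (pushforward u) = u"
  by (simp add: pullback_def pushforward_def fun_eq_iff)

lemma Ck_on_pullback:
  assumes "open \<Omega>'" "Ck_on k \<Omega>' f" "open (base -` \<Omega>')"
  shows "Ck_on k (base -` \<Omega>') (pullback f)"
  unfolding Ck_on_def pullback_def
proof (intro allI impI)
  fix n assume "enat n \<le> k"
  then have "Cn_on n \<Omega>' f" using assms(2) by (simp add: Ck_on_def)
  then have "Cn_on n (base -` \<Omega>') (\<lambda>p. f (base p))"
    using Cn_on_compose[OF assms(3,1) Cn_on_base[OF assms(3)]] by blast
  then show "Cn_on n (base -` \<Omega>') (\<lambda>p. weight p * f (base p))"
    by (intro Cn_on_mult assms(3) Cn_on_weight)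
qed

text \<open>Describes images as preimages under \<open>base_inv\<close>, so that their openness
  follows from continuity of \<open>base_inv\<close> on the half-space.\<close>

lemma base_image: "base ` \<Omega> = {q. 0 < fst q} \<inter> base_inv -` \<Omega>"
proof
  show "{q. 0 < fst q} \<inter> base_inv -` \<Omega> \<subseteq> base ` \<Omega>"
    using base_base_inv by (metis (no_types, lifting) Int_iff imageI mem_Collect_eq subsetI vimageD)
qed auto

lemma open_base_vimage: "open \<Omega>' \<Longrightarrow> open (base -` \<Omega>')"
  using Cn_on_base[OF open_UNIV, of 0] by (intro open_vimage) auto

lemma open_base_image: "open \<Omega> \<Longrightarrow> open (base ` \<Omega>)"
  unfolding base_image using Cn_on_base_inv[of 0] open_half_space
  by (metis Cn_on.simps(1) continuous_on_open_vimage inf_commute)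

lemma Ck_on_pushforward:
  assumes "open \<Omega>" "Ck_on k \<Omega> u"
  shows "Ck_on k (base ` \<Omega>) (pushforward u)"
  unfolding Ck_on_def pushforward_def
proof (intro allI impI)
  fix n assume "enat n \<le> k"
  then have u: "Cn_on n \<Omega> u" using assms(2) by (simp add: Ck_on_def)
  have open_image: "open (base ` \<Omega>)" using assms(1) by (rule open_base_image)
  have inv: "Cn_on n (base ` \<Omega>) base_inv"
    by (rule Cn_on_subset[OF Cn_on_base_inv]) auto
  show "Cn_on n (base ` \<Omega>) (\<lambda>q. inv_weight (base_inv q) * u (base_inv q))"
    by (intro Cn_on_mult open_image Cn_on_compose[OF open_image assms(1) inv] u
        Cn_on_inv_weight assms(1)) auto
qed

text \<open>After the chain rule the coefficients of \<open>f\<close> and of its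
  \<open>X\<close>-derivative cancel, leaving the Kolmogorov defect at \<open>base p\<close> times a
  nonzero factor; hence an equivalence and not just an implication.\<close>

lemma kramers_pullback_iff:
  assumes f: "Cn_on 2 \<Omega>' f" and "open \<Omega>'" and "base p \<in> \<Omega>'"
  shows "kramers \<gamma> \<beta> (pullback f) p \<longleftrightarrow> kolmogorov f (base p)"
proof (cases p)
  case (fields t x y)
  have f_diff: "f differentiable (at q)" "D\<^sub>x f differentiable (at q)" if "q \<in> \<Omega>'" for q
    using f that \<open>open \<Omega>'\<close> Cn_on_D\<^sub>x[of 1 \<Omega>' f] Cn_on_differentiable_at[of _ \<Omega>']
    by (metis One_nat_def Suc_1)+
  \<comment> \<open>\<open>w\<close>, \<open>W\<close> and \<open>q\<close> are functions of the
    \<open>x\<close>-variable with \<open>t\<close> and \<open>y\<close> frozen, because two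
    \<open>x\<close>-derivatives are taken.\<close>
  define E where "E = exp (\<alpha> * t)"
  define w where "w = (\<lambda>s. s + 3 * \<alpha> * y)"
  define W where "W = (\<lambda>s. weight (t, s, y))"
  define q where "q = (\<lambda>s. base (t, s, y))"
  have q_x: "q x = (\<kappa> * exp (2 * \<alpha> * t), exp (\<alpha> * t) * (x + 3 * \<alpha> * y), \<gamma> * exp (3 * \<alpha> * t) * y)"
    by (simp add: q_def base_def)
  have q_in: "q x \<in> \<Omega>'" using assms(3) by (simp add: q_def fields)
  have u: "pullback f (t, x, y) = W x * f (q x)"
    by (simp add: pullback_def W_def q_def)
  have u_t: "D\<^sub>t (pullback f) (t, x, y) = W x * (\<mu> * f (q x)
      + 2 * \<alpha> * (\<kappa> * exp (2 * \<alpha> * t)) * D\<^sub>t f (q x)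
      + \<alpha> * E * w x * D\<^sub>x f (q x) + 3 * \<alpha> * \<gamma> * exp (3 * \<alpha> * t) * y * D\<^sub>y f (q x))"
  proof -
    have "((\<lambda>s. weight (s, x, y)) has_real_derivative \<mu> * weight (t, x, y)) (at t)"
      unfolding weight_def prod.case by (rule derivative_eq_intros refl | simp)+
    note W_deriv = this
    have "((\<lambda>s. f (base (s, x, y))) has_real_derivative
        2 * \<alpha> * (\<kappa> * exp (2 * \<alpha> * t)) * D\<^sub>t f (q x)
        + \<alpha> * E * w x * D\<^sub>x f (q x) + 3 * \<alpha> * \<gamma> * exp (3 * \<alpha> * t) * y * D\<^sub>y f (q x)) (at t)"
      unfolding base_def prod.case
      by (rule DERIV_chain_partial, rule f_diff(1)[OF q_in[unfolded q_x]])
        (rule derivative_eq_intros refl | simp add: q_x E_def w_def)+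
    from DERIV_imp_deriv[OF DERIV_mult'[OF W_deriv this]] show ?thesis
      by (simp add: pullback_def W_def q_def algebra_simps)
  qed
  have u_y: "D\<^sub>y (pullback f) (t, x, y) = W x * (6 * \<alpha> * l * w x * f (q x)
      + 3 * \<alpha> * E * D\<^sub>x f (q x) + \<gamma> * exp (3 * \<alpha> * t) * D\<^sub>y f (q x))"
  proof -
    have "((\<lambda>s. weight (t, x, s)) has_real_derivative 6 * \<alpha> * l * w x * weight (t, x, y)) (at y)"
      unfolding weight_def prod.case by (rule derivative_eq_intros refl | simp add: w_def)+
    note W_deriv = this
    have "((\<lambda>s. f (base (t, x, s))) has_real_derivative
        3 * \<alpha> * E * D\<^sub>x f (q x) + \<gamma> * exp (3 * \<alpha> * t) * D\<^sub>y f (q x)) (at y)"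
      unfolding base_def prod.case
      by (rule DERIV_chain_partial, rule f_diff(1)[OF q_in[unfolded q_x]])
        (rule derivative_eq_intros refl | simp add: q_x E_def)+
    from DERIV_imp_deriv[OF DERIV_mult'[OF W_deriv this]] show ?thesis
      by (simp add: pullback_def W_def q_def algebra_simps)
  qed
  have W': "(W has_real_derivative 2 * l * w s * W s) (at s)" for s
    unfolding W_def weight_def w_def prod.case
    by (rule derivative_eq_intros refl | simp)+
  have chain: "((\<lambda>s. g (q s)) has_real_derivative E * D\<^sub>x g (q s)) (at s)"
    if "g differentiable (at (q s))" for g s
    using that unfolding q_def base_def prod.case
    by (rule DERIV_chain_partial) (rule derivative_eq_intros refl | simp add: E_def)+
  \<comment> \<open>Needed at every \<open>s\<close> with \<open>q s\<close> in the domain, not just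
    at \<open>x\<close>, because the formula is differentiated once more.\<close>
  have u_x: "D\<^sub>x (pullback f) (t, s, y) = W s * (2 * l * w s * f (q s) + E * D\<^sub>x f (q s))"
    if "q s \<in> \<Omega>'" for s
    using DERIV_imp_deriv[OF DERIV_mult'[OF W' chain[OF f_diff(1)[OF that]]]]
    by (simp add: pullback_def W_def q_def algebra_simps)
  have u_xx: "D\<^sub>x (D\<^sub>x (pullback f)) (t, x, y) = W x * ((4 * l\<^sup>2 * (w x)\<^sup>2 + 2 * l) * f (q x)
      + 4 * l * w x * E * D\<^sub>x f (q x) + E\<^sup>2 * D\<^sub>x (D\<^sub>x f) (q x))"
  proof -
    \<comment> \<open>Continuity of \<open>q\<close> makes the formula for the first derivative
      valid near \<open>x\<close>, and the outer \<open>deriv\<close> depends only on that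
      germ.\<close>
    have "isCont q x" unfolding q_def base_def prod.case by (intro continuous_intros)
    then have "eventually (\<lambda>s. q s \<in> \<Omega>') (nhds x)"
      using q_in \<open>open \<Omega>'\<close> by (simp add: continuous_at topological_tendstoD tendsto_nhds_iff)
    then have ev: "eventually (\<lambda>s. D\<^sub>x (pullback f) (t, s, y)
        = W s * (2 * l * w s * f (q s) + E * D\<^sub>x f (q s))) (nhds x)"
      by eventually_elim (rule u_x)
    have w': "(w has_real_derivative 1) (at s)" for s
      unfolding w_def by (rule derivative_eq_intros refl | simp)+
    have "((\<lambda>s. W s * (2 * l * w s * f (q s) + E * D\<^sub>x f (q s))) has_real_derivative
        W x * ((4 * l\<^sup>2 * (w x)\<^sup>2 + 2 * l) * f (q x)
          + 4 * l * w x * E * D\<^sub>x f (q x) + E\<^sup>2 * D\<^sub>x (D\<^sub>x f) (q x))) (at x)"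
      by (rule DERIV_cong[OF DERIV_mult'[OF W' DERIV_add[OF
            DERIV_mult'[OF DERIV_cmult[OF w'] chain[OF f_diff(1)[OF q_in]]]
            DERIV_cmult[OF chain[OF f_diff(2)[OF q_in]]]]]])
        (simp add: algebra_simps power2_eq_square)
    from DERIV_imp_deriv[OF this] show ?thesis
      by (simp only: D\<^sub>x.simps(1)[of "D\<^sub>x (pullback f)"] deriv_cong_ev[OF ev refl])
  qed
  \<comment> \<open>All exponentials become powers of \<open>E\<close>, so what remains is
    polynomial algebra.\<close>
  have E: "exp (2 * \<alpha> * t) = E\<^sup>2" "exp (3 * \<alpha> * t) = E ^ 3"
    unfolding E_def exp_of_nat_mult[symmetric] by (simp_all add: mult.assoc)
  \<comment> \<open>Coefficient of \<open>f\<close>. Its non-constant part has the factor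
    \<open>2 * w x\<close>; \<open>weight_x\<close> and \<open>weight_y\<close> annihilate the
    \<open>x\<close>- and \<open>y\<close>-terms of the cofactor, and \<open>weight_1\<close> the
    constants.\<close>
  have c0: "\<mu> + 6 * \<alpha> * l * w x * x - \<gamma> * (4 * l\<^sup>2 * (w x)\<^sup>2 + 2 * l)
      - \<gamma> * (x + \<beta> * y) * (2 * l * w x) - \<gamma> = 0"
  proof -
    have "6 * \<alpha> * l * w x * x - \<gamma> * (4 * l\<^sup>2 * (w x)\<^sup>2) - \<gamma> * (x + \<beta> * y) * (2 * l * w x)
        = 2 * w x * (x * (l * (3 * \<alpha> - 2 * \<gamma> * l - \<gamma>)) - y * (l * (6 * \<gamma> * l * \<alpha> + \<gamma> * \<beta>)))"
      by (simp add: w_def algebra_simps power2_eq_square)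
    then show ?thesis
      unfolding weight_x weight_y mult_zero_right diff_self weight_1
      by (simp add: distrib_left mult.commute mult.left_commute)
  qed
  \<comment> \<open>Coefficient of \<open>E * D\<^sub>x f\<close>, linear in \<open>x\<close> and
    \<open>y\<close>; \<open>drift_x\<close> and \<open>drift_y\<close> annihilate its two
    parts.\<close>
  have c1: "\<alpha> * w x + 3 * \<alpha> * x - \<gamma> * (4 * l * w x) - \<gamma> * (x + \<beta> * y) = 0"
  proof -
    have "\<alpha> * w x + 3 * \<alpha> * x - \<gamma> * (4 * l * w x) - \<gamma> * (x + \<beta> * y)
        = x * (4 * \<alpha> - (4 * \<gamma> * l + \<gamma>)) + y * (3 * \<alpha>\<^sup>2 - (12 * \<gamma> * l * \<alpha> + \<gamma> * \<beta>))"
      by (simp add: w_def algebra_simps power2_eq_square)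
    then show ?thesis by (simp only: drift_x drift_y diff_self mult_zero_right add_0)
  qed
  \<comment> \<open>The \<open>D\<^sub>y f\<close> terms from the time derivative and from the
    transport term combine through \<open>x + 3 * \<alpha> * y = w x\<close>; then
    \<open>E * w x\<close> is the new \<open>X\<close>, as the Kolmogorov equation requires.\<close>
  have "D\<^sub>t (pullback f) (t, x, y) + x * D\<^sub>y (pullback f) (t, x, y)
      - (\<gamma> * D\<^sub>x (D\<^sub>x (pullback f)) (t, x, y)
        + \<gamma> * (x + \<beta> * y) * D\<^sub>x (pullback f) (t, x, y) + \<gamma> * pullback f (t, x, y))
    = W x * (f (q x) * (\<mu> + 6 * \<alpha> * l * w x * x - \<gamma> * (4 * l\<^sup>2 * (w x)\<^sup>2 + 2 * l)
          - \<gamma> * (x + \<beta> * y) * (2 * l * w x) - \<gamma>)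
        + E * D\<^sub>x f (q x)
          * (\<alpha> * w x + 3 * \<alpha> * x - \<gamma> * (4 * l * w x) - \<gamma> * (x + \<beta> * y))
        + E\<^sup>2 * (2 * \<alpha> * \<kappa> * D\<^sub>t f (q x) + \<gamma> * (E * w x) * D\<^sub>y f (q x)
          - \<gamma> * D\<^sub>x (D\<^sub>x f) (q x)))"
    unfolding u u_t u_y u_xx u_x[OF q_in] E
    by (simp add: w_def algebra_simps power2_eq_square power3_eq_cube)
  \<comment> \<open>\<open>\<gamma>_eq\<close> turns the coefficient
    \<open>2 * \<alpha> * \<kappa>\<close> of \<open>D\<^sub>t f\<close> into
    \<open>\<gamma>\<close>, so all three surviving terms share one factor.\<close>
  also have "\<dots> = W x * \<gamma> * E\<^sup>2 * (D\<^sub>t f (q x) + E * w x * D\<^sub>y f (q x) - D\<^sub>x (D\<^sub>x f) (q x))"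
    unfolding c0 c1 \<gamma>_eq[symmetric] by (simp add: algebra_simps)
  finally have "kramers \<gamma> \<beta> (pullback f) (t, x, y) \<longleftrightarrow>
      W x * \<gamma> * E\<^sup>2 * (D\<^sub>t f (q x) + E * w x * D\<^sub>y f (q x) - D\<^sub>x (D\<^sub>x f) (q x)) = 0"
    unfolding kramers.simps by linarith
  also have "\<dots> \<longleftrightarrow> D\<^sub>t f (q x) + E * w x * D\<^sub>y f (q x) = D\<^sub>x (D\<^sub>x f) (q x)"
    using \<gamma>_nonzero by (simp add: E_def W_def weight_def)
  also have "\<dots> \<longleftrightarrow> kolmogorov f (base p)"
    by (simp add: fields base_def q_x E_def w_def)
  finally show ?thesis by (simp add: fields)
qed

section \<open>Transfer of solutions and their graphs\<close>

lemma solution_pullback: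
  assumes "2 \<le> k" "solution k kolmogorov \<Omega>' f"
  shows "solution k (kramers \<gamma> \<beta>) (base -` \<Omega>') (pullback f)"
proof -
  have "Cn_on 2 \<Omega>' f" and *: "open \<Omega>'" "Ck_on k \<Omega>' f" "\<forall>q\<in>\<Omega>'. kolmogorov f q"
    using assms by (auto simp: solution_def Ck_on_def numeral_eq_enat)
  then show ?thesis
    using kramers_pullback_iff Ck_on_pullback open_base_vimage
    by (simp add: solution_def)
qed

text \<open>\<open>u\<close> is the pullback of its pushforward, so
  \<open>kramers_pullback_iff\<close> is read from left to right with \<open>f\<close> the
  pushforward.\<close>

lemma solution_pushforward:
  assumes "2 \<le> k" "solution k (kramers \<gamma> \<beta>) \<Omega> u"
  shows "solution k kolmogorov (base ` \<Omega>) (pushforward u)"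
proof -
  have *: "open \<Omega>" "Ck_on k \<Omega> u" "\<forall>p\<in>\<Omega>. kramers \<gamma> \<beta> u p"
    using assms(2) by (auto simp: solution_def)
  have push: "open (base ` \<Omega>)" "Ck_on k (base ` \<Omega>) (pushforward u)"
    using * by (simp_all add: open_base_image Ck_on_pushforward)
  then have "Cn_on 2 (base ` \<Omega>) (pushforward u)"
    using assms(1) by (simp add: Ck_on_def numeral_eq_enat)
  then have "kolmogorov (pushforward u) (base p)" if "p \<in> \<Omega>" for p
    using kramers_pullback_iff[of "base ` \<Omega>" "pushforward u" p] push(1) that *(3)
    by (simp add: pullback_pushforward)
  with push show ?thesis by (auto simp: solution_def)
qed

lemma pulls_back_pullback: "pulls_back \<Phi> \<Omega>' f (base -` \<Omega>') (pullback f)"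
proof -
  have "\<Phi> (t, x, y, u) \<in> graph_on \<Omega>' f \<longleftrightarrow> (t, x, y, u) \<in> graph_on (base -` \<Omega>') (pullback f)"
    for t x y u
  proof -
    obtain T X Y where b: "base (t, x, y) = (T, X, Y)" by (cases "base (t, x, y)")
    have "inv_weight (t, x, y) * u = f (T, X, Y) \<longleftrightarrow> u = weight (t, x, y) * f (T, X, Y)"
      by (metis weight_inv_weight)
    then show ?thesis by (auto simp: graph_on_def \<Phi>_def pullback_def b)
  qed
  then have "z \<in> \<Phi> -` graph_on \<Omega>' f \<longleftrightarrow> z \<in> graph_on (base -` \<Omega>') (pullback f)" for z
    by (cases z) (simp only: vimage_eq)
  then show ?thesis unfolding pulls_back_def by blast
qed

text \<open>The image of a preimage is the intersection with the range, here the whole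
  graph.\<close>

lemma \<Phi>_image_pullback:
  assumes "graph_on \<Omega>' f \<subseteq> range \<Phi>"
  shows "\<Phi> ` graph_on (base -` \<Omega>') (pullback f) = graph_on \<Omega>' f"
  using assms pulls_back_pullback[of \<Omega>' f, unfolded pulls_back_def]
    image_vimage_eq[of \<Phi> "graph_on \<Omega>' f"]
  by (simp add: Int_absorb2)

lemma maps_equation_\<Phi>:
  assumes "2 \<le> k"
  shows "maps_equation k \<Phi> (kramers \<gamma> \<beta>) kolmogorov"
  unfolding maps_equation_def
proof (intro conjI allI impI)
  fix \<Omega> u assume u: "solution k (kramers \<gamma> \<beta>) \<Omega> u"
  have "graph_on (base ` \<Omega>) (pushforward u) \<subseteq> range \<Phi>"
    unfolding range_\<Phi> graph_on_def using base_image by auto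
  moreover have "base -` base ` \<Omega> = \<Omega>" 
    by (intro inj_vimage_image_eq inj_on_inverseI[where g = base_inv] base_inv_base)
  ultimately have "\<Phi> ` graph_on \<Omega> u = graph_on (base ` \<Omega>) (pushforward u)"
    using \<Phi>_image_pullback[of "base ` \<Omega>" "pushforward u"] by (simp add: pullback_pushforward)
  with solution_pushforward[OF assms u]
  show "\<exists>\<Omega>' u'. solution k kolmogorov \<Omega>' u' \<and> \<Phi> ` graph_on \<Omega> u = graph_on \<Omega>' u'" by blast
next
  fix \<Omega>' u' assume "solution k kolmogorov \<Omega>' u' \<and> graph_on \<Omega>' u' \<subseteq> range \<Phi>"
  then show "\<exists>\<Omega> u. solution k (kramers \<gamma> \<beta>) \<Omega> u \<and> \<Phi> ` graph_on \<Omega> u = graph_on \<Omega>' u'"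
    using solution_pullback[OF assms] \<Phi>_image_pullback by blast
qed

end

section \<open>The two concrete transformations as members of the family\<close>

lemma kramers\<^sub>1_eq: "kramers\<^sub>1 \<gamma> = kramers \<gamma> (- 3/4 * \<gamma>)"
  by (simp add: fun_eq_iff)

lemma kramers\<^sub>2_eq: "kramers\<^sub>2 \<gamma> = kramers \<gamma> (3/16 * \<gamma>)"
  by (simp add: fun_eq_iff)

theorem mainTheorem7:
  fixes \<gamma> :: real and k :: enat
  assumes "\<gamma> \<noteq> 0" and "2 \<le> k"
  shows
    "point_transformation (\<Phi>\<^sub>1 \<gamma>) \<and> maps_equation k (\<Phi>\<^sub>1 \<gamma>) (kramers\<^sub>1 \<gamma>) kolmogorov \<and>
     point_transformation (\<Phi>\<^sub>2 \<gamma>) \<and> maps_equation k (\<Phi>\<^sub>2 \<gamma>) (kramers\<^sub>2 \<gamma>) kolmogorov \<and>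
     (\<forall>\<Omega>' f. solution k kolmogorov \<Omega>' f \<longrightarrow>
       (let \<Omega> = {(t, x, y).
              (exp (\<gamma> * t), exp (1/2 * \<gamma> * t) * (x + 3/2 * \<gamma> * y), \<gamma> * exp (3/2 * \<gamma> * t) * y) \<in> \<Omega>'};
            u = (\<lambda>(t, x, y).
              exp (1/4 * (x + 3/2 * \<gamma> * y)\<^sup>2 + 3/2 * \<gamma> * t) *
              f (exp (\<gamma> * t), exp (1/2 * \<gamma> * t) * (x + 3/2 * \<gamma> * y), \<gamma> * exp (3/2 * \<gamma> * t) * y))
        in pulls_back (\<Phi>\<^sub>1 \<gamma>) \<Omega>' f \<Omega> u \<and> solution k (kramers\<^sub>1 \<gamma>) \<Omega> u) \<and>
       (let \<Omega> = {(t, x, y).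
              (2 * exp (1/2 * \<gamma> * t), exp (1/4 * \<gamma> * t) * (x + 3/4 * \<gamma> * y),
               \<gamma> * exp (3/4 * \<gamma> * t) * y) \<in> \<Omega>'};
            u = (\<lambda>(t, x, y).
              exp (\<gamma> * t) *
              f (2 * exp (1/2 * \<gamma> * t), exp (1/4 * \<gamma> * t) * (x + 3/4 * \<gamma> * y),
                 \<gamma> * exp (3/4 * \<gamma> * t) * y))
        in pulls_back (\<Phi>\<^sub>2 \<gamma>) \<Omega>' f \<Omega> u \<and> solution k (kramers\<^sub>2 \<gamma>) \<Omega> u))"
proof -
  \<comment> \<open>The parameters are read off the exponents of
    \<open>\<Phi>\<^sub>1 \<gamma>\<close>: \<alpha> from \<open>X\<close>, \<kappa> from
    \<open>T\<close>, \<open>l\<close> and \<mu> from the factor of \<open>u\<close>.\<close>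
  interpret A: kramers_to_kolmogorov \<gamma> "1/2 * \<gamma>" 1 "1/4" "3/2 * \<gamma>" "- 3/4 * \<gamma>"
    using assms(1) by unfold_locales (auto simp: power2_eq_square)
  \<comment> \<open>Here the factor of \<open>u\<close> depends on \<open>t\<close> only, so
    \<open>l = 0\<close> and the conditions \<open>weight_x\<close> and \<open>weight_y\<close> are
    trivial.\<close>
  interpret B: kramers_to_kolmogorov \<gamma> "1/4 * \<gamma>" 2 0 \<gamma> "3/16 * \<gamma>"
    using assms(1) by unfold_locales (auto simp: power2_eq_square)
  have A_base: "A.base (t, x, y) = (exp (\<gamma> * t), exp (1/2 * \<gamma> * t) * (x + 3/2 * \<gamma> * y),
      \<gamma> * exp (3/2 * \<gamma> * t) * y)" for t x y
    unfolding A.base_def by simp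
  have B_base: "B.base (t, x, y) = (2 * exp (1/2 * \<gamma> * t), exp (1/4 * \<gamma> * t) * (x + 3/4 * \<gamma> * y),
      \<gamma> * exp (3/4 * \<gamma> * t) * y)" for t x y
    unfolding B.base_def by simp
  have A_\<Phi>: "A.\<Phi> = \<Phi>\<^sub>1 \<gamma>"
    unfolding fun_eq_iff A.\<Phi>_def A.inv_weight_def split_paired_All prod.case A_base by simp
  have B_\<Phi>: "B.\<Phi> = \<Phi>\<^sub>2 \<gamma>"
    unfolding fun_eq_iff B.\<Phi>_def B.inv_weight_def split_paired_All prod.case B_base by simp
  have A_pullback: "A.base -` \<Omega>' = {(t, x, y). (exp (\<gamma> * t),
        exp (1/2 * \<gamma> * t) * (x + 3/2 * \<gamma> * y), \<gamma> * exp (3/2 * \<gamma> * t) * y) \<in> \<Omega>'}"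
    "A.pullback f = (\<lambda>(t, x, y). exp (1/4 * (x + 3/2 * \<gamma> * y)\<^sup>2 + 3/2 * \<gamma> * t) *
        f (exp (\<gamma> * t), exp (1/2 * \<gamma> * t) * (x + 3/2 * \<gamma> * y), \<gamma> * exp (3/2 * \<gamma> * t) * y))"
    for \<Omega>' f
    unfolding fun_eq_iff set_eq_iff split_paired_All A.pullback_def A.weight_def vimage_eq A_base
    by auto
  have B_pullback: "B.base -` \<Omega>' = {(t, x, y). (2 * exp (1/2 * \<gamma> * t),
        exp (1/4 * \<gamma> * t) * (x + 3/4 * \<gamma> * y), \<gamma> * exp (3/4 * \<gamma> * t) * y) \<in> \<Omega>'}"
    "B.pullback f = (\<lambda>(t, x, y). exp (\<gamma> * t) * f (2 * exp (1/2 * \<gamma> * t),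
        exp (1/4 * \<gamma> * t) * (x + 3/4 * \<gamma> * y), \<gamma> * exp (3/4 * \<gamma> * t) * y))"
    for \<Omega>' f
    unfolding fun_eq_iff set_eq_iff split_paired_All B.pullback_def B.weight_def vimage_eq B_base
    by auto
  \<comment> \<open>Folding the explicit formulas back into the family's names reduces the goal to
    the facts proved for the family.\<close>
  show ?thesis
    unfolding Let_def kramers\<^sub>1_eq kramers\<^sub>2_eq
      A_\<Phi>[symmetric] B_\<Phi>[symmetric] A_pullback[symmetric] B_pullback[symmetric]
    using A.point_transformation_\<Phi> B.point_transformation_\<Phi>
      A.maps_equation_\<Phi> B.maps_equation_\<Phi> A.pulls_back_pullback B.pulls_back_pullback
      A.solution_pullback B.solution_pullback assms(2)
    by blast
qed

end
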